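(* Let $\mathbb{E}$ and $\mathbb{W}$ be real normed spaces, and suppose there is an inner product $(\cdot\mid\cdot)_{\mathbb{E}}$ on $\mathbb{E}$ which is continuous as a function $\mathbb{E}\times\mathbb{E}\to\mathbb{R}$ (for the norm topology of $\mathbb{E}$). Let $W$ be an open subset of $\mathbb{W}$ and $e_1,\dots,e_n\in C^0(W,\mathbb{E})$ be such that $e_1(w),\dots,e_n(w)$ are linearly independent for all $w\in W$. Then there exist $\epsilon_1,\dots,\epsilon_n\in C^0(W,\mathbb{E}\setminus\{0\})$ such that: (a) for all $w\in W$ and all $i\in\{1,\dots,n\}$, $\epsilon_i(w)\in\mathrm{span}\{e_1(w),\dots,e_i(w)\}$; (b) for all $w\in W$ and all $i\ne j$ in $\{1,\dots,n\}$, $(\epsilon_i(w)\mid\epsilon_j(w))_{\mathbb{E}}=0$; (c) for all $(i,j)\in\{1,\dots,n\}^2$ there exists $\alpha^i_j\in C^0(W,\mathbb{R})$ such that for all $w\in W$, $\epsilon_j(w)=\sum_{i=1}^n\alpha^i_j(w)e_i(w)$, where $\alpha^j_j(w)=1$ and $\alpha^i_j(w)=0$ when $i>j$.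
   Context: $C^0(A,B)$ denotes the continuous mappings from $A$ into $B$. The inner product need not induce the norm of $\mathbb{E}$. *)

theory Defs
  imports "HOL-Analysis.Analysis"
begin

(* The inner product of real_inner induces the norm of its type, so an inner product
   unrelated to the norm has to be a predicate on functions. *)
definition inner_product :: "('e::real_vector \<Rightarrow> 'e \<Rightarrow> real) \<Rightarrow> bool" where
  "inner_product ip \<longleftrightarrow>
     bilinear ip \<and> (\<forall>x y. ip x y = ip y x) \<and> (\<forall>x. x \<noteq> 0 \<longrightarrow> ip x x > 0)"

(* Independence of the family, not just of its set of values: without injectivity,
   e i = e j for i \<noteq> j would be allowed. *)
definition independent_family :: "'i set \<Rightarrow> ('i \<Rightarrow> 'e::real_vector) \<Rightarrow> bool" where
  "independent_family I v \<longleftrightarrow> inj_on v I \<and> independent (v ` I)"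

lemma independent_family_iff:
  assumes "finite I"
  shows "independent_family I v \<longleftrightarrow>
    (\<forall>c. (\<Sum>i\<in>I. c i *\<^sub>R v i) = 0 \<longrightarrow> (\<forall>i\<in>I. c i = 0))"
proof
  assume L: "independent_family I v"
  show "\<forall>c. (\<Sum>i\<in>I. c i *\<^sub>R v i) = 0 \<longrightarrow> (\<forall>i\<in>I. c i = 0)"
  proof (intro allI impI ballI)
    fix c i assume s: "(\<Sum>i\<in>I. c i *\<^sub>R v i) = 0" and i: "i \<in> I"
    have inj: "inj_on v I" and ind: "independent (v ` I)"
      using L by (auto simp: independent_family_def)
    have "(\<Sum>x\<in>v ` I. c (the_inv_into I v x) *\<^sub>R x) = 0"
      using s by (simp add: sum.reindex[OF inj] the_inv_into_f_f[OF inj])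
    then have "c (the_inv_into I v (v i)) = 0"
      using independentD[OF ind, of "v ` I" "\<lambda>x. c (the_inv_into I v x)" "v i"] assms i by auto
    then show "c i = 0" by (simp add: the_inv_into_f_f[OF inj i])
  qed
next
  assume R: "\<forall>c. (\<Sum>i\<in>I. c i *\<^sub>R v i) = 0 \<longrightarrow> (\<forall>i\<in>I. c i = 0)"
  have inj: "inj_on v I"
  proof (rule inj_onI, rule ccontr)
    fix i j assume ij: "i \<in> I" "j \<in> I" "v i = v j" "i \<noteq> j"
    let ?c = "\<lambda>k. (if k = i then 1 else 0) - (if k = j then 1 else (0::real))"
    have "(\<Sum>k\<in>I. ?c k *\<^sub>R v k) =
        (\<Sum>k\<in>I. if k = i then v k else 0) - (\<Sum>k\<in>I. if k = j then v k else 0)"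
      unfolding sum_subtractf[symmetric] by (rule sum.cong) auto
    also have "\<dots> = 0" using ij assms by simp
    finally have "?c i = 0" by (rule R[rule_format, OF _ ij(1)])
    then show False using ij by simp
  qed
  have "independent (v ` I)"
  proof
    assume "dependent (v ` I)"
    then obtain u where u: "(\<Sum>x\<in>v ` I. u x *\<^sub>R x) = 0" and nz: "\<exists>i\<in>I. u (v i) \<noteq> 0"
      using dependent_finite[of "v ` I"] assms by auto
    have "(\<Sum>i\<in>I. u (v i) *\<^sub>R v i) = 0"
      using u by (simp add: sum.reindex[OF inj])
    then have "\<forall>i\<in>I. u (v i) = 0"
      by (rule R[THEN spec[of _ "\<lambda>i. u (v i)"], THEN mp])
    with nz show False by blast
  qed
  with inj show "independent_family I v" by (simp add: independent_family_def)
qed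

end

(* Gram-Schmidt without normalisation. The coefficients of the orthogonal vectors
   with respect to the original family are unitriangular, so independence makes the vectors
   nonzero; the projection coefficients are then quotients of continuous functions with
   nonvanishing denominator. *)

theory Submission
  imports Defs
begin

lemma inner_product_linear_right: "inner_product ip \<Longrightarrow> linear (ip x)"
  by (simp add: inner_product_def bilinear_def)

lemma inner_product_linear_left: "inner_product ip \<Longrightarrow> linear (\<lambda>x. ip x y)"
  by (simp add: inner_product_def bilinear_def)

lemma inner_product_commute: "inner_product ip \<Longrightarrow> ip x y = ip y x"
  by (simp add: inner_product_def)

lemma inner_product_self_eq_0_iff:
  assumes "inner_product ip"
  shows "ip x x = 0 \<longleftrightarrow> x = 0"
proof
  show "ip x x = 0 \<Longrightarrow> x = 0"
    using assms unfolding inner_product_def by (metis less_irrefl)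
  show "x = 0 \<Longrightarrow> ip x x = 0"
    using linear_0[OF inner_product_linear_right[OF assms]] by simp
qed

text \<open>By linearity in the first argument, pairing the projection sum with \<open>u j\<close>
  leaves only the term \<open>k = j\<close>, the others vanishing by \<open>orth\<close>.
  Definiteness makes the denominator \<open>ip (u j) (u j)\<close> nonzero, so that term cancels to
  \<open>ip x (u j)\<close>.\<close>

lemma inner_product_diff_projections:
  assumes ip: "inner_product ip" and "finite K" "j \<in> K" and nz: "u j \<noteq> 0"
    and orth: "\<And>k. k \<in> K \<Longrightarrow> k \<noteq> j \<Longrightarrow> ip (u k) (u j) = 0"
  shows "ip (x - (\<Sum>k\<in>K. (ip x (u k) / ip (u k) (u k)) *\<^sub>R u k)) (u j) = 0"
proof -
  note lin = inner_product_linear_left[OF ip, of "u j"]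
  let ?c = "\<lambda>k. ip x (u k) / ip (u k) (u k)"
  have "ip (\<Sum>k\<in>K. ?c k *\<^sub>R u k) (u j) = (\<Sum>k\<in>K. ?c k * ip (u k) (u j))"
    by (simp add: linear_sum[OF lin] linear_scale[OF lin])
  also have "\<dots> = (\<Sum>k\<in>K. if k = j then ?c j * ip (u j) (u j) else 0)"
    using orth by (intro sum.cong) auto
  also have "\<dots> = ip x (u j)"
    using assms inner_product_self_eq_0_iff[OF ip] by simp
  finally show ?thesis by (simp add: linear_diff[OF lin])
qed

text \<open>Composition of \<open>ip\<close> with the continuous map
  \<open>w \<mapsto> (f w, g w)\<close>. Joint continuity enters as an assumption because
  \<open>ip\<close> is not tied to the topology of the space.\<close>

lemma continuous_on_inner_product:
  fixes ip :: "'e::topological_space \<Rightarrow> 'e \<Rightarrow> real"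
  assumes "continuous_on UNIV (\<lambda>(x, y). ip x y)" "continuous_on W f" "continuous_on W g"
  shows "continuous_on W (\<lambda>w. ip (f w) (g w))"
  using continuous_on_compose2[OF assms(1) continuous_on_Pair[OF assms(2,3)]] by simp

text \<open>Contrapositive of \<open>independent_family_iff\<close>. Applied to a coefficient equal
  to 1, it keeps each newly built vector away from 0.\<close>

lemma independent_family_sum_nonzero:
  assumes "finite I" "independent_family I v" "j \<in> I" "a j \<noteq> 0"
  shows "(\<Sum>i\<in>I. a i *\<^sub>R v i) \<noteq> 0"
  using assms independent_family_iff by blast

text \<open>Induction on the number \<open>m\<close> of vectors already built, with \<open>n\<close>
  fixed so that all expansions run over the same index range. The coefficients
  \<open>\<alpha>\<close> are carried along because their triangular shape is what yields
  \<open>u w \<noteq> 0\<close> in the next step; span membership can be read off from them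
  afterwards.\<close>

lemma gram_schmidt_continuous:
  fixes ip :: "'e::real_normed_vector \<Rightarrow> 'e \<Rightarrow> real"
    and W :: "'w::topological_space set"
  assumes ip: "inner_product ip"
    and cip: "continuous_on UNIV (\<lambda>(x, y). ip x y)"
    and ce: "\<And>i. i \<in> {1..n} \<Longrightarrow> continuous_on W (e i)"
    and ind: "\<And>w. w \<in> W \<Longrightarrow> independent_family {1..n} (\<lambda>i. e i w)"
    and "m \<le> n"
  shows "\<exists>(\<epsilon> :: nat \<Rightarrow> 'w \<Rightarrow> 'e) (\<alpha> :: nat \<Rightarrow> nat \<Rightarrow> 'w \<Rightarrow> real).
    (\<forall>j\<in>{1..m}. continuous_on W (\<epsilon> j) \<and> (\<forall>i\<in>{1..n}. continuous_on W (\<alpha> i j))) \<and>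
    (\<forall>w\<in>W. \<forall>i\<in>{1..m}. \<forall>j\<in>{1..m}. i \<noteq> j \<longrightarrow> ip (\<epsilon> i w) (\<epsilon> j w) = 0) \<and>
    (\<forall>w\<in>W. \<forall>j\<in>{1..m}. \<epsilon> j w \<noteq> 0 \<and> \<epsilon> j w = (\<Sum>i=1..n. \<alpha> i j w *\<^sub>R e i w) \<and>
       \<alpha> j j w = 1 \<and> (\<forall>i\<in>{1..n}. i > j \<longrightarrow> \<alpha> i j w = 0))"
  using \<open>m \<le> n\<close>
proof (induction m)
  case 0
  show ?case by simp
next
  case (Suc m)
  then obtain \<epsilon> :: "nat \<Rightarrow> 'w \<Rightarrow> 'e" and \<alpha> :: "nat \<Rightarrow> nat \<Rightarrow> 'w \<Rightarrow> real" where IH: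
    "\<forall>j\<in>{1..m}. continuous_on W (\<epsilon> j) \<and> (\<forall>i\<in>{1..n}. continuous_on W (\<alpha> i j))"
    "\<forall>w\<in>W. \<forall>i\<in>{1..m}. \<forall>j\<in>{1..m}. i \<noteq> j \<longrightarrow> ip (\<epsilon> i w) (\<epsilon> j w) = 0"
    "\<forall>w\<in>W. \<forall>j\<in>{1..m}. \<epsilon> j w \<noteq> 0 \<and> \<epsilon> j w = (\<Sum>i=1..n. \<alpha> i j w *\<^sub>R e i w) \<and>
       \<alpha> j j w = 1 \<and> (\<forall>i\<in>{1..n}. i > j \<longrightarrow> \<alpha> i j w = 0)"
    using Suc_leD[OF Suc.prems] by blast
  have c\<epsilon>: "continuous_on W (\<epsilon> j)" if "j \<in> {1..m}" for j
    using IH(1) that by blast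
  have c\<alpha>: "continuous_on W (\<alpha> i j)" if "i \<in> {1..n}" "j \<in> {1..m}" for i j
    using IH(1) that by blast
  have orth: "ip (\<epsilon> i w) (\<epsilon> j w) = 0"
    if "w \<in> W" "i \<in> {1..m}" "j \<in> {1..m}" "i \<noteq> j" for w i j
    using IH(2) that by blast
  have nz: "\<epsilon> j w \<noteq> 0" and sum: "\<epsilon> j w = (\<Sum>i=1..n. \<alpha> i j w *\<^sub>R e i w)" and diag: "\<alpha> j j w = 1"
    if "w \<in> W" "j \<in> {1..m}" for w j
    using IH(3) that by blast+
  have tri: "\<alpha> i j w = 0" if "w \<in> W" "j \<in> {1..m}" "i \<in> {1..n}" "i > j" for w i j
    using IH(3) that by blast
  \<comment> \<open>\<open>c\<close> holds the projection coefficients and \<open>u\<close> is the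
    next orthogonal vector. Replacing each \<open>\<epsilon> k\<close> in \<open>u\<close> by its
    expansion in the family \<open>e\<close> gives the coefficients \<open>a\<close>.\<close>
  define c where "c k w = ip (e (Suc m) w) (\<epsilon> k w) / ip (\<epsilon> k w) (\<epsilon> k w)" for k w
  define u where "u w = e (Suc m) w - (\<Sum>k=1..m. c k w *\<^sub>R \<epsilon> k w)" for w
  define a where "a i w = (if i = Suc m then 1 else 0) - (\<Sum>k=1..m. c k w * \<alpha> i k w)" for i w
  \<comment> \<open>The denominator has no zero on \<open>W\<close>, by \<open>nz\<close> and
    definiteness of \<open>ip\<close>.\<close>
  have cc: "continuous_on W (c k)" if "k \<in> {1..m}" for k
    unfolding c_def using that nz Suc.prems
    by (intro continuous_on_divide continuous_on_inner_product[OF cip] ce c\<epsilon>)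
       (auto simp: inner_product_self_eq_0_iff[OF ip])
  have cu: "continuous_on W u"
    unfolding u_def using Suc.prems
    by (intro continuous_intros ce cc c\<epsilon>) auto
  have ca: "continuous_on W (a i)" if "i \<in> {1..n}" for i
    unfolding a_def using that by (intro continuous_intros cc c\<alpha>) auto
  \<comment> \<open>Expand every \<open>\<epsilon> k w\<close>, exchange the two sums, and write
    \<open>e (Suc m) w\<close> as a Kronecker delta sum, which is possible because
    \<open>Suc m \<le> n\<close>.\<close>
  have au: "u w = (\<Sum>i=1..n. a i w *\<^sub>R e i w)" if w: "w \<in> W" for w
  proof -
    have "(\<Sum>k=1..m. c k w *\<^sub>R \<epsilon> k w) = (\<Sum>k=1..m. \<Sum>i=1..n. (c k w * \<alpha> i k w) *\<^sub>R e i w)"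
      using sum[OF w] by (intro sum.cong) (simp_all add: scaleR_sum_right)
    also have "\<dots> = (\<Sum>i=1..n. (\<Sum>k=1..m. c k w * \<alpha> i k w) *\<^sub>R e i w)"
      by (subst sum.swap) (simp add: scaleR_sum_left)
    moreover have "e (Suc m) w = (\<Sum>i=1..n. (if i = Suc m then 1 else 0) *\<^sub>R e i w)"
      using Suc.prems by (simp add: if_distrib[of "\<lambda>r. r *\<^sub>R _"] cong: if_cong)
    ultimately show ?thesis
      by (simp add: u_def a_def scaleR_diff_left sum_subtractf)
  qed
  \<comment> \<open>Every \<open>k \<le> m\<close> satisfies \<open>k < i\<close>, so all
    \<open>\<alpha> i k w\<close> in the sum vanish. This covers both the diagonal entry 1 at
    \<open>i = Suc m\<close> and the zeros beyond it.\<close>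
  have atri: "a i w = (if i = Suc m then 1 else 0)" if "w \<in> W" "i \<in> {1..n}" "i > m" for i w
    using that tri by (simp add: a_def)
  have unz: "u w \<noteq> 0" if "w \<in> W" for w
    using independent_family_sum_nonzero[OF _ ind[OF that], of "Suc m" "\<lambda>i. a i w"]
      atri[OF that, of "Suc m"] au[OF that] Suc.prems by simp
  have uorth: "ip (u w) (\<epsilon> j w) = 0" if "w \<in> W" "j \<in> {1..m}" for w j
    unfolding u_def c_def using that nz orth
    by (intro inner_product_diff_projections[OF ip]) auto
  have split: "j \<in> {1..Suc m} \<longleftrightarrow> j = Suc m \<or> j \<in> {1..m}" for j by auto
  \<comment> \<open>Only index \<open>Suc m\<close> is overridden, so the induction hypothesis still
    speaks about all smaller indices.\<close>
  let ?\<epsilon> = "\<lambda>j. if j = Suc m then u else \<epsilon> j"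
  let ?\<alpha> = "\<lambda>i j. if j = Suc m then a i else \<alpha> i j"
  have "continuous_on W (?\<epsilon> j) \<and> (\<forall>i\<in>{1..n}. continuous_on W (?\<alpha> i j))"
    if "j \<in> {1..Suc m}" for j
    using that cu ca c\<epsilon> c\<alpha> unfolding split by auto
  \<comment> \<open>\<open>uorth\<close> has \<open>u\<close> as first argument; symmetry of
    \<open>ip\<close> handles the pairs where it is second.\<close>
  moreover have "ip (?\<epsilon> i w) (?\<epsilon> j w) = 0"
    if "w \<in> W" "i \<in> {1..Suc m}" "j \<in> {1..Suc m}" "i \<noteq> j" for w i j
    using that orth uorth inner_product_commute[OF ip, of "\<epsilon> i w" "u w"] unfolding split by auto
  moreover have "?\<epsilon> j w \<noteq> 0 \<and> ?\<epsilon> j w = (\<Sum>i=1..n. ?\<alpha> i j w *\<^sub>R e i w) \<and>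
      ?\<alpha> j j w = 1 \<and> (\<forall>i\<in>{1..n}. i > j \<longrightarrow> ?\<alpha> i j w = 0)"
    if "w \<in> W" "j \<in> {1..Suc m}" for w j
  proof (cases "j = Suc m")
    case True
    then show ?thesis using that unz au atri Suc.prems by simp
  next
    case False
    then have "j \<in> {1..m}" using that by auto
    then show ?thesis using IH(3) that(1) unfolding if_not_P[OF False] by blast
  qed
  ultimately show ?case
    by (intro exI[of _ ?\<epsilon>] exI[of _ ?\<alpha>]) blast
qed

theorem lemma4p2:
  fixes ip :: "'e::real_normed_vector \<Rightarrow> 'e \<Rightarrow> real"
    and W :: "'w::real_normed_vector set"
    and n :: nat
    and e :: "nat \<Rightarrow> 'w \<Rightarrow> 'e"
  assumes "inner_product ip"
    and "continuous_on UNIV (\<lambda>(x, y). ip x y)"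
    and "open W"
    and "\<And>i. i \<in> {1..n} \<Longrightarrow> continuous_on W (e i)"
    and "\<And>w. w \<in> W \<Longrightarrow> independent_family {1..n} (\<lambda>i. e i w)"
  shows "\<exists>\<epsilon> :: nat \<Rightarrow> 'w \<Rightarrow> 'e.
    (\<forall>i\<in>{1..n}. continuous_on W (\<epsilon> i) \<and> \<epsilon> i \<in> W \<rightarrow> UNIV - {0}) \<and>
    (\<forall>w\<in>W. \<forall>i\<in>{1..n}. \<epsilon> i w \<in> span ((\<lambda>k. e k w) ` {1..i})) \<and>
    (\<forall>w\<in>W. \<forall>i\<in>{1..n}. \<forall>j\<in>{1..n}. i \<noteq> j \<longrightarrow> ip (\<epsilon> i w) (\<epsilon> j w) = 0) \<and>
    (\<exists>\<alpha> :: nat \<Rightarrow> nat \<Rightarrow> 'w \<Rightarrow> real.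
       (\<forall>i\<in>{1..n}. \<forall>j\<in>{1..n}. continuous_on W (\<alpha> i j)) \<and>
       (\<forall>w\<in>W. \<forall>j\<in>{1..n}.
          \<epsilon> j w = (\<Sum>i=1..n. \<alpha> i j w *\<^sub>R e i w) \<and>
          \<alpha> j j w = 1 \<and>
          (\<forall>i\<in>{1..n}. i > j \<longrightarrow> \<alpha> i j w = 0)))"
proof -
  obtain \<epsilon> :: "nat \<Rightarrow> 'w \<Rightarrow> 'e" and \<alpha> :: "nat \<Rightarrow> nat \<Rightarrow> 'w \<Rightarrow> real" where
    cont: "\<forall>j\<in>{1..n}. continuous_on W (\<epsilon> j) \<and> (\<forall>i\<in>{1..n}. continuous_on W (\<alpha> i j))" and
    orth: "\<forall>w\<in>W. \<forall>i\<in>{1..n}. \<forall>j\<in>{1..n}. i \<noteq> j \<longrightarrow> ip (\<epsilon> i w) (\<epsilon> j w) = 0" and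
    sum: "\<forall>w\<in>W. \<forall>j\<in>{1..n}. \<epsilon> j w \<noteq> 0 \<and> \<epsilon> j w = (\<Sum>i=1..n. \<alpha> i j w *\<^sub>R e i w) \<and>
       \<alpha> j j w = 1 \<and> (\<forall>i\<in>{1..n}. i > j \<longrightarrow> \<alpha> i j w = 0)"
    using gram_schmidt_continuous[OF assms(1,2,4,5) order_refl] by blast
  have "\<epsilon> j w \<in> span ((\<lambda>k. e k w) ` {1..j})" if "w \<in> W" "j \<in> {1..n}" for w j
  proof -
    \<comment> \<open>Terms with \<open>i \<le> j\<close> are multiples of generators, and those
      with \<open>i > j\<close> have coefficient 0.\<close>
    have "\<alpha> i j w *\<^sub>R e i w \<in> span ((\<lambda>k. e k w) ` {1..j})" if "i \<in> {1..n}" for i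
    proof (cases "i \<le> j")
      case True
      then show ?thesis using that by (intro span_scale span_base imageI) simp
    next
      case False
      then show ?thesis using sum \<open>w \<in> W\<close> \<open>j \<in> {1..n}\<close> that by (simp add: span_zero)
    qed
    then have "(\<Sum>i=1..n. \<alpha> i j w *\<^sub>R e i w) \<in> span ((\<lambda>k. e k w) ` {1..j})"
      by (rule span_sum)
    then show ?thesis using sum that by simp
  qed
  moreover have "\<epsilon> i \<in> W \<rightarrow> UNIV - {0}" if "i \<in> {1..n}" for i
    using sum that by blast
  ultimately show ?thesis
    using cont orth sum by (intro exI[of _ \<epsilon>] conjI exI[of _ \<alpha>]) blast+
qed

end
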